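(* Let $k,n\in\mathbb{N}$ with $1\le k\le n-1$ and let $G$ be a maximal $k$-degenerate graph of order $n$. If $I$ is a nondecreasing distance-based topological index, then \[ I(G)\le I(P_n^k). \] If $I$ is a nonincreasing distance-based topological index, then \[ I(G)\ge I(P_n^k). \]
   Context: All graphs are finite and simple. The order of a graph is its number of vertices. A graph $G$ is $k$-degenerate if every (nonempty) induced subgraph of $G$ contains a vertex of degree at most $k$ (in that subgraph). A $k$-degenerate graph is maximal $k$-degenerate if after adding any edge (between two nonadjacent vertices) it is no longer $k$-degenerate. (It is known that a maximal $k$-degenerate graph of order at least $k+1$ is $k$-connected, hence connected.) $P_n$ is the path on $n$ vertices. The $k$-th power $G^k$ of a graph $G$ is the graph on the same vertex set in which two distinct vertices are adjacent if their distance in $G$ is at most $k$. For a connected graph $G$, $d_G(u,v)$ is the usual shortest-path distance. The distance sequence $\mathcal{D}(G)$ of a connected graph $G$ is the nondecreasing sequence (of length $\binom{n}{2}$ if $G$ has order $n$) of the distances between all unordered pairs of distinct vertices of $G$, with repetitions. A topological index $I$, assigning a real number to each connected graph, is distance-based if it can be expressed in the form $I(G)=g(\mathcal{D}(G))$, where $g$ is a real-valued function defined on the set of all finite sequences of positive integers. It is called nondecreasing (nonincreasing) if $g$, when restricted to sequences of any fixed length, is nondecreasing (nonincreasing) in every coordinate. *)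

theory Defs
  imports "Graph_Theory.Graph_Theory"
begin

text \<open>
  A finite simple graph is a \<^locale>\<open>pair_graph\<close>: a finite vertex set together with a symmetric
  irreflexive set of arcs, so that an edge $uv$ is the pair of arcs \<open>(u,v)\<close>, \<open>(v,u)\<close> and the degree
  of a vertex is its \<^const>\<open>out_degree\<close>.
\<close>

definition degenerate :: "nat \<Rightarrow> 'a pair_pre_digraph \<Rightarrow> bool" where
  "degenerate k G \<longleftrightarrow>
     (\<forall>H :: 'a pair_pre_digraph.
        induced_subgraph (with_proj H) (with_proj G) \<and> pverts H \<noteq> {} \<longrightarrow>
        (\<exists>v \<in> pverts H. out_degree (with_proj H) v \<le> k))"

definition add_edge :: "'a \<Rightarrow> 'a \<Rightarrow> 'a pair_pre_digraph \<Rightarrow> 'a pair_pre_digraph" where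
  "add_edge u v G = \<lparr>pverts = pverts G, parcs = {(u, v), (v, u)} \<union> parcs G\<rparr>"

definition maximal_degenerate :: "nat \<Rightarrow> 'a pair_pre_digraph \<Rightarrow> bool" where
  "maximal_degenerate k G \<longleftrightarrow>
     degenerate k G \<and>
     (\<forall>u \<in> pverts G. \<forall>v \<in> pverts G.
        u \<noteq> v \<and> (u, v) \<notin> parcs G \<longrightarrow> \<not> degenerate k (add_edge u v G))"

text \<open>Only meaningful if \<open>v\<close> is reachable from \<open>u\<close>; for unreachable \<open>v\<close> the value is arbitrary.\<close>

definition gdist :: "'a pair_pre_digraph \<Rightarrow> 'a \<Rightarrow> 'a \<Rightarrow> nat" where
  "gdist G u v = (LEAST l. \<exists>p. pre_digraph.awalk (with_proj G) u p v \<and> length p = l)"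

definition graph_power :: "'a pair_pre_digraph \<Rightarrow> nat \<Rightarrow> 'a pair_pre_digraph" where
  "graph_power G k =
     \<lparr>pverts = pverts G,
      parcs = {(u, v). u \<in> pverts G \<and> v \<in> pverts G \<and> u \<noteq> v \<and>
                       u \<rightarrow>\<^sup>*\<^bsub>with_proj G\<^esub> v \<and> gdist G u v \<le> k}\<rparr>"

text \<open>
  $P_n$ is only determined up to isomorphism. The predicate describes its copies with vertices in
  the type \<open>'a\<close>.
\<close>

definition is_path_graph :: "nat \<Rightarrow> 'a pair_pre_digraph \<Rightarrow> bool" where
  "is_path_graph n P \<longleftrightarrow>
     (\<exists>f. bij_betw f {..<n} (pverts P) \<and>
          parcs P = {(f i, f j) | i j. i < n \<and> j < n \<and> (j = Suc i \<or> i = Suc j)})"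

text \<open>
  The unordered pairs of distinct vertices are the two-element subsets of the vertex set. The
  description operator below picks the common value of \<open>gdist G u v\<close> and \<open>gdist G v u\<close>.
\<close>

definition pair_dist :: "'a pair_pre_digraph \<Rightarrow> 'a set \<Rightarrow> nat" where
  "pair_dist G e = (THE d. \<exists>u v. e = {u, v} \<and> d = gdist G u v)"

definition distance_sequence :: "'a pair_pre_digraph \<Rightarrow> nat list" where
  "distance_sequence G =
     sorted_list_of_multiset
       (image_mset (pair_dist G) (mset_set {e. e \<subseteq> pverts G \<and> card e = 2}))"

text \<open>
  The domain of \<open>g\<close> is the set of sequences of positive integers, and an index is defined on
  connected graphs only. Hence the values elsewhere are left unconstrained.
\<close>

definition index_given_by ::
    "('a pair_pre_digraph \<Rightarrow> real) \<Rightarrow> (nat list \<Rightarrow> real) \<Rightarrow> bool" where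
  "index_given_by I g \<longleftrightarrow>
     (\<forall>G. pair_graph G \<and> connected (with_proj G) \<longrightarrow> I G = g (distance_sequence G))"

definition nondecreasing_coords :: "(nat list \<Rightarrow> real) \<Rightarrow> bool" where
  "nondecreasing_coords g \<longleftrightarrow>
     (\<forall>xs i y. (\<forall>x \<in> set xs. 0 < x) \<and> i < length xs \<and> xs ! i \<le> y \<longrightarrow> g xs \<le> g (xs[i := y]))"

definition nonincreasing_coords :: "(nat list \<Rightarrow> real) \<Rightarrow> bool" where
  "nonincreasing_coords g \<longleftrightarrow>
     (\<forall>xs i y. (\<forall>x \<in> set xs. 0 < x) \<and> i < length xs \<and> xs ! i \<le> y \<longrightarrow> g (xs[i := y]) \<le> g xs)"

definition nondecreasing_distance_based :: "('a pair_pre_digraph \<Rightarrow> real) \<Rightarrow> bool" where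
  "nondecreasing_distance_based I \<longleftrightarrow> (\<exists>g. index_given_by I g \<and> nondecreasing_coords g)"

definition nonincreasing_distance_based :: "('a pair_pre_digraph \<Rightarrow> real) \<Rightarrow> bool" where
  "nonincreasing_distance_based I \<longleftrightarrow> (\<exists>g. index_given_by I g \<and> nonincreasing_coords g)"

text \<open>Every set of \<open>n\<close> vertices carries a copy of $P_n$, which is a simple graph.\<close>

lemma ex_is_path_graph:
  assumes "finite V" and "card V = n"
  shows "\<exists>P. pverts P = V \<and> is_path_graph n P"
proof -
  obtain f where f: "bij_betw f {..<n} V"
    using assms ex_bij_betw_nat_finite[of V] by (auto simp: atLeast0LessThan)
  show ?thesis
    by (rule exI[of _ "\<lparr>pverts = V,
          parcs = {(f i, f j) | i j. i < n \<and> j < n \<and> (j = Suc i \<or> i = Suc j)}\<rparr>"])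
      (use f in \<open>auto simp: is_path_graph_def\<close>)
qed

lemma pair_graph_is_path_graph:
  assumes "is_path_graph n P"
  shows "pair_graph P"
proof -
  obtain f where f: "bij_betw f {..<n} (pverts P)"
    and E: "parcs P = {(f i, f j) | i j. i < n \<and> j < n \<and> (j = Suc i \<or> i = Suc j)}"
    using assms unfolding is_path_graph_def by blast
  have fin: "finite (pverts P)"
    using f bij_betw_finite by blast
  have sub: "parcs P \<subseteq> pverts P \<times> pverts P"
    using f E by (auto simp: bij_betw_def)
  have inj: "inj_on f {..<n}"
    using f by (simp add: bij_betw_def)
  show ?thesis
  proof
    show "finite (parcs P)"
      using fin sub finite_subset by blast
    show "symmetric (with_proj P)"
      unfolding symmetric_def sym_def with_proj_simps E by blast
    show "fst e \<noteq> snd e" if "e \<in> parcs P" for e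
      using that inj unfolding E by (auto simp: inj_on_eq_iff)
  qed (use fin sub in auto)
qed

text \<open>The distance is the library's shortest path weight for unit weights.\<close>

lemma (in pair_wf_digraph) gdist_eq_shortest_path:
  assumes "u \<rightarrow>\<^sup>*\<^bsub>with_proj G\<^esub> v"
  shows "ereal (real (gdist G u v)) = \<mu> (\<lambda>_. 1) u v"
proof -
  let ?L = "\<lambda>l. \<exists>p. awalk u p v \<and> length p = l"
  have cost: "awalk_cost (\<lambda>_. 1) p = real (length p)" for p :: "('a \<times> 'a) list"
    by (induction p) auto
  obtain p0 where "awalk u p0 v"
    using assms reachable_awalk by blast
  then have "?L (LEAST l. ?L l)"
    by (intro LeastI[of ?L "length p0"]) blast
  then obtain p where p: "awalk u p v" "length p = gdist G u v"
    unfolding gdist_def by blast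
  have le: "gdist G u v \<le> length q" if "awalk u q v" for q
    unfolding gdist_def using that by (intro Least_le) blast
  show ?thesis
    unfolding \<mu>_def cost
  proof (intro antisym INF_greatest)
    show "(INF q \<in> {q. awalk u q v}. ereal (real (length q))) \<le> ereal (real (gdist G u v))"
      using p by (intro INF_lower2[of p]) auto
  qed (use le in auto)
qed

end

theory Submission
  imports Defs
begin

text \<open>
  Deleting a vertex of degree at most \<open>k\<close> from a maximal \<open>k\<close>-degenerate graph leaves a maximal
  \<open>k\<close>-degenerate graph, and maximality forces the degree to be exactly \<open>k\<close>. So the graph arises
  from $K_{k+1}$ by repeatedly attaching a vertex with \<open>k\<close> neighbours. Every vertex cut of such a
  graph has at least \<open>k\<close> elements, hence every ball of radius \<open>d\<close> has at least
  $\min(n, dk + 1)$ elements. Induction along the construction then bounds the number of pairs at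
  distance more than \<open>d\<close> by $\binom{n-dk}{2}$, which is attained by $P_n^k$. The counts for all \<open>d\<close>
  give the comparison of the sorted distance sequences term by term.
\<close>

section \<open>Attaching vertices of degree k\<close>

text \<open>\<open>N\<close> is an arbitrary \<open>k\<close>-subset, not necessarily a clique, so
  the class contains all k-trees of order at least k + 1. The smallest order is
  \<open>Suc k\<close>, which fits the bound k \<le> n - 1 of the theorem.\<close>

inductive built_up :: "nat \<Rightarrow> 'a set \<Rightarrow> 'a rel \<Rightarrow> bool" for k where
  complete: "finite V \<Longrightarrow> card V = Suc k \<Longrightarrow> built_up k V {(u, v). u \<in> V \<and> v \<in> V \<and> u \<noteq> v}"
| attach: "built_up k V E \<Longrightarrow> v \<notin> V \<Longrightarrow> N \<subseteq> V \<Longrightarrow> card N = k \<Longrightarrow>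
    built_up k (insert v V) (E \<union> {v} \<times> N \<union> N \<times> {v})"

lemma built_up_finite: "built_up k V E \<Longrightarrow> finite V"
  by (induction rule: built_up.induct) auto

lemma built_up_subset: "built_up k V E \<Longrightarrow> E \<subseteq> V \<times> V"
  by (induction rule: built_up.induct) auto

lemma built_up_sym: "built_up k V E \<Longrightarrow> sym E"
  by (induction rule: built_up.induct) (auto simp: sym_def)

text \<open>Neighbours are intersected with \<open>W\<close>, so \<open>E\<close> may have pairs
  outside \<open>V\<close>. Hence a vertex can be deleted from \<open>V\<close> without restricting
  the relation.\<close>

definition rel_degenerate :: "nat \<Rightarrow> 'a set \<Rightarrow> 'a rel \<Rightarrow> bool" where
  "rel_degenerate k V E \<longleftrightarrow> (\<forall>W \<subseteq> V. W \<noteq> {} \<longrightarrow> (\<exists>v \<in> W. card (E `` {v} \<inter> W) \<le> k))"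

text \<open>In a set containing \<open>v\<close>, the vertex \<open>v\<close> itself has low degree;
  any other set lies in \<open>V\<close>.\<close>

lemma rel_degenerate_insert:
  assumes "finite V" and "rel_degenerate k V E" and "card (E `` {v} \<inter> insert v V) \<le> k"
  shows "rel_degenerate k (insert v V) E"
  unfolding rel_degenerate_def
proof (intro allI impI)
  fix W assume W: "W \<subseteq> insert v V" "W \<noteq> {}"
  show "\<exists>w \<in> W. card (E `` {w} \<inter> W) \<le> k"
  proof (cases "v \<in> W")
    case True
    have "card (E `` {v} \<inter> W) \<le> card (E `` {v} \<inter> insert v V)"
      using W assms(1) by (intro card_mono) auto
    with assms(3) have "card (E `` {v} \<inter> W) \<le> k" by simp
    with True show ?thesis by blast
  next
    case False
    with W have "W \<subseteq> V" by auto
    with W assms(2) show ?thesis by (simp add: rel_degenerate_def)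
  qed
qed

text \<open>A vertex of low degree for \<open>E\<close> keeps low degree when edges inside
  \<open>V'\<close> are lost. This serves both to shrink the vertex set and to exchange relations
  that agree on it.\<close>

lemma rel_degenerate_cong:
  assumes "rel_degenerate k V E" and "V' \<subseteq> V" and "E' \<inter> V' \<times> V' \<subseteq> E" and "finite V"
  shows "rel_degenerate k V' E'"
  unfolding rel_degenerate_def
proof (intro allI impI)
  fix W assume W: "W \<subseteq> V'" "W \<noteq> {}"
  then obtain v where v: "v \<in> W" "card (E `` {v} \<inter> W) \<le> k"
    using assms unfolding rel_degenerate_def by (meson order_trans)
  have "card (E' `` {v} \<inter> W) \<le> card (E `` {v} \<inter> W)"
    using assms v W finite_subset[OF _ assms(4), of W] by (intro card_mono) auto
  with v have "card (E' `` {v} \<inter> W) \<le> k" by simp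
  with v show "\<exists>w \<in> W. card (E' `` {w} \<inter> W) \<le> k" by blast
qed

text \<open>Without loops, a vertex has at most \<open>k\<close> possible neighbours here. Hence
  maximality on exactly k + 1 vertices forces the complete graph, the base case below.\<close>

lemma rel_degenerate_small:
  assumes "finite V" and "card V \<le> Suc k" and "irrefl E"
  shows "rel_degenerate k V E"
  unfolding rel_degenerate_def
proof (intro allI impI)
  fix W assume W: "W \<subseteq> V" "W \<noteq> {}"
  then obtain v where v: "v \<in> W" by auto
  have fW: "finite W" using W assms finite_subset by blast
  have "card (E `` {v} \<inter> W) \<le> card (W - {v})"
    using assms(3) fW by (intro card_mono) (auto simp: irrefl_def)
  also have "\<dots> \<le> k"
    using card_mono[OF assms(1) W(1)] assms(2) v fW by simp
  finally show "\<exists>w \<in> W. card (E `` {w} \<inter> W) \<le> k" using v by auto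
qed

text \<open>Induction on the order: a vertex \<open>v\<close> of degree at most \<open>k\<close> is
  removed. Maximality is used twice, to show that \<open>v\<close> has degree exactly
  \<open>k\<close> and to pass to the remaining graph.\<close>

lemma maximal_rel_degenerate_built_up:
  assumes "finite V" and "E \<subseteq> V \<times> V" and "sym E" and "irrefl E" and "Suc k \<le> card V"
    and "rel_degenerate k V E"
    and "\<And>u v. u \<in> V \<Longrightarrow> v \<in> V \<Longrightarrow> u \<noteq> v \<Longrightarrow> (u, v) \<notin> E \<Longrightarrow>
           \<not> rel_degenerate k V ({(u, v), (v, u)} \<union> E)"
  shows "built_up k V E"
  using assms
proof (induction "card V" arbitrary: V E)
  case 0
  then show ?case by simp
next
  case (Suc n)
  show ?case
  proof (cases "card V = Suc k")
    case True
    have "(u, v) \<in> E" if uv: "u \<in> V" "v \<in> V" "u \<noteq> v" for u v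
    proof (rule ccontr)
      assume "(u, v) \<notin> E"
      moreover have "rel_degenerate k V ({(u, v), (v, u)} \<union> E)"
        using Suc.prems True uv by (intro rel_degenerate_small) (auto simp: irrefl_def)
      ultimately show False using Suc.prems(7) uv by blast
    qed
    then have "E = {(u, v). u \<in> V \<and> v \<in> V \<and> u \<noteq> v}"
      using Suc.prems(2,4) by (auto simp: irrefl_def)
    then show ?thesis
      using built_up.complete[OF Suc.prems(1) True] by simp
  next
    case False
    then have big: "Suc k < card V" using Suc.prems(5) by simp
    then have "V \<noteq> {}" by auto
    then obtain v where v: "v \<in> V" "card (E `` {v} \<inter> V) \<le> k"
      using Suc.prems(6) unfolding rel_degenerate_def by blast
    define V0 where "V0 = V - {v}"
    define N where "N = E `` {v}"
    define E0 where "E0 = E \<inter> V0 \<times> V0"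
    have fin0: "finite V0" and card0: "card V0 = n" and V: "V = insert v V0" "v \<notin> V0"
      using Suc.prems(1) Suc.hyps(2) v by (auto simp: V0_def)
    have N: "N \<subseteq> V0"
      using Suc.prems(2,4) by (auto simp: N_def V0_def irrefl_def)
    have cN: "card N \<le> k"
      using v N by (simp add: N_def V0_def Int_absorb2 subset_eq)
    have E: "E = E0 \<union> {v} \<times> N \<union> N \<times> {v}"
      using Suc.prems(2,3,4) by (auto simp: E0_def N_def V0_def irrefl_def sym_def)
    have deg: "rel_degenerate k V F"
      if "rel_degenerate k V0 F" "card (F `` {v} \<inter> V) \<le> k" for F
      using rel_degenerate_insert[OF fin0] that V by metis
    have deg0: "rel_degenerate k V0 E"
      using rel_degenerate_cong[OF Suc.prems(6)] Suc.prems(1) by (auto simp: V0_def)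
    have "card N = k"
    proof (rule ccontr)
      assume "card N \<noteq> k"
      then have less: "card N < k" using cN by simp
      have "N \<noteq> V0" using less card0 big Suc.hyps(2) by auto
      then obtain u where u: "u \<in> V0" "u \<notin> N" using N by auto
      \<comment> \<open>\<open>V0\<close> has more than \<open>k\<close> vertices and
        \<open>N\<close> fewer, so a non-neighbour \<open>u\<close> of \<open>v\<close> exists. The
        new edge raises the degree of \<open>v\<close> to at most \<open>k\<close> and changes
        nothing inside \<open>V0\<close>.\<close>
      let ?F = "{(v, u), (u, v)} \<union> E"
      have "?F `` {v} \<inter> V \<subseteq> insert u N"
        using u V by (auto simp: N_def)
      then have "card (?F `` {v} \<inter> V) \<le> card (insert u N)"
        using N fin0 by (intro card_mono) (auto intro: finite_subset)
      also have "\<dots> \<le> k" using less u finite_subset[OF N fin0] by simp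
      finally have "rel_degenerate k V ?F"
        using rel_degenerate_cong[OF deg0, of V0 ?F] fin0 V by (intro deg) auto
      then show False
        using Suc.prems(7)[of v u] u V v by (auto simp: N_def)
    qed
    moreover have "built_up k V0 E0"
    proof (rule Suc.hyps(1))
      show "n = card V0" by (simp add: card0)
      show "E0 \<subseteq> V0 \<times> V0" "sym E0" "irrefl E0"
        using Suc.prems(3,4) by (auto simp: E0_def sym_def irrefl_def)
      show "Suc k \<le> card V0" using big Suc.hyps(2) card0 by simp
      show "rel_degenerate k V0 E0"
        using rel_degenerate_cong[OF deg0, of V0] fin0 by (auto simp: E0_def)
      fix x y assume xy: "x \<in> V0" "y \<in> V0" "x \<noteq> y" "(x, y) \<notin> E0"
      show "\<not> rel_degenerate k V0 ({(x, y), (y, x)} \<union> E0)"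
      proof
        \<comment> \<open>An edge that can be added inside \<open>V0\<close> can be added to the
          whole graph as well, since the neighbourhood of \<open>v\<close> remains
          \<open>N\<close>.\<close>
        assume "rel_degenerate k V0 ({(x, y), (y, x)} \<union> E0)"
        then have "rel_degenerate k V0 ({(x, y), (y, x)} \<union> E)"
          using fin0 by (elim rel_degenerate_cong) (auto simp: E0_def)
        moreover have "({(x, y), (y, x)} \<union> E) `` {v} \<inter> V = N"
          using xy V N by (auto simp: N_def)
        ultimately have "rel_degenerate k V ({(x, y), (y, x)} \<union> E)"
          using cN by (intro deg) auto
        then show False using Suc.prems(7)[of x y] xy V by (auto simp: E0_def)
      qed
    qed (fact fin0)
    ultimately show ?thesis
      using built_up.attach[of k V0 E0 v N] N V E by simp
  qed
qed

section \<open>Growth of balls\<close>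

text \<open>The vertex cut bound: the outer neighbours of \<open>A\<close> separate \<open>A\<close>
  from any vertices left over. In the induction, \<open>A\<close> is compared with its part among
  the old vertices; if there is none, the outer neighbours are exactly \<open>N\<close>.\<close>

lemma built_up_expansion:
  assumes "built_up k V E" and "A \<subseteq> V" and "A \<noteq> {}"
  shows "V \<subseteq> A \<union> E `` A \<or> k \<le> card (E `` A - A)"
  using assms
proof (induction arbitrary: A rule: built_up.induct)
  case (complete V)
  then show ?case by auto
next
  case (attach V E v N)
  let ?E = "E \<union> {v} \<times> N \<union> N \<times> {v}"
  have fin: "finite V" "E \<subseteq> V \<times> V"
    using attach.hyps built_up_finite built_up_subset by blast+
  have fN: "finite N" using fin attach.hyps(3) finite_subset by blast
  have finE: "finite (?E `` A)"
    by (rule finite_subset[of _ "insert v V"]) (use fin attach.hyps(3) in auto)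
  show ?case
  proof (cases "A = {v}")
    case True
    then have "?E `` A - A = N"
      using attach.hyps(2,3) fin by auto
    then show ?thesis using attach.hyps(4) by simp
  next
    case False
    define B where "B = A - {v}"
    have B: "B \<subseteq> V" "B \<noteq> {}" using False attach.prems by (auto simp: B_def)
    \<comment> \<open>\<open>E\<close> does not touch \<open>v\<close>, so no old outer neighbour of
      \<open>B\<close> equals \<open>v\<close>, the only element that \<open>A\<close> may have
      beyond \<open>B\<close>.\<close>
    have sub: "E `` B - B \<subseteq> ?E `` A - A"
      using attach.hyps(2) fin by (auto simp: B_def)
    consider "V \<subseteq> B \<union> E `` B" | "k \<le> card (E `` B - B)"
      using attach.IH[OF B] by auto
    then show ?thesis
    proof cases
      case 1
      show ?thesis
      proof (cases "v \<in> A \<union> ?E `` A")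
        case True
        then show ?thesis using 1 by (auto simp: B_def)
      next
        case False
        \<comment> \<open>If \<open>v\<close> is not reached, no element of \<open>N\<close> is in
          \<open>A\<close>; but \<open>A\<close> reaches all old vertices, so all \<open>k\<close>
          elements of \<open>N\<close> are outer neighbours.\<close>
        then have "A = B" "N \<inter> A = {}" by (auto simp: B_def)
        then have "N \<subseteq> E `` A - A" using 1 attach.hyps(3) by blast
        then have "N \<subseteq> ?E `` A - A" by blast
        then show ?thesis
          using card_mono[of "?E `` A - A" N] finE attach.hyps(4) by simp
      qed
    next
      case 2
      then show ?thesis
        using card_mono[OF _ sub] finE by simp
    qed
  qed
qed

text \<open>Powers of the reflexive closure give balls, as a step may stand still. Each increase of
  the radius adds \<open>k\<close> new vertices or exhausts \<open>V\<close>.\<close>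

lemma built_up_ball:
  assumes "built_up k V E" and "u \<in> V"
  shows "min (card V) (Suc (d * k)) \<le> card ((E\<^sup>= ^^ d) `` {u})"
proof (induction d)
  case 0
  then show ?case by simp
next
  case (Suc d)
  let ?B = "(E\<^sup>= ^^ d) `` {u}"
  have finV: "finite V" and sub: "E \<subseteq> V \<times> V"
    using assms(1) by (auto dest: built_up_finite built_up_subset)
  have inV: "(E\<^sup>= ^^ e) `` {u} \<subseteq> V" for e
    using assms(2) sub by (induction e) (auto simp: relcomp.simps)
  have step: "(E\<^sup>= ^^ Suc d) `` {u} = ?B \<union> E `` ?B" by auto
  have fin: "finite ?B" "finite (E `` ?B - ?B)"
    using inV[of d] inV[of "Suc d"] finV finite_subset[of _ V] unfolding step by blast+
  have "u \<in> ?B" by (induction d) auto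
  then have "?B \<noteq> {}" by blast
  then consider "V \<subseteq> ?B \<union> E `` ?B" | "k \<le> card (E `` ?B - ?B)"
    using built_up_expansion[OF assms(1) inV] by blast
  then show ?case
  proof cases
    case 1
    then have "(E\<^sup>= ^^ Suc d) `` {u} = V" using inV[of "Suc d"] step by auto
    then show ?thesis by simp
  next
    case 2
    have "card ((E\<^sup>= ^^ Suc d) `` {u}) = card (?B \<union> (E `` ?B - ?B))"
      unfolding step by (simp add: Un_Diff_cancel)
    also have "\<dots> = card ?B + card (E `` ?B - ?B)"
      using fin by (intro card_Un_disjoint) auto
    finally show ?thesis using 2 Suc.IH by simp
  qed
qed

lemma built_up_connected:
  assumes "built_up k V E" and "1 \<le> k" and "u \<in> V" and "v \<in> V"
  shows "(u, v) \<in> E\<^sup>*"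
proof -
  \<comment> \<open>This radius suffices: for k \<ge> 1 the lower bound on the ball is
    \<open>card V\<close>.\<close>
  let ?B = "(E\<^sup>= ^^ card V) `` {u}"
  have "?B \<subseteq> E\<^sup>* `` {u}"
    using relpow_imp_rtrancl[of _ "card V" "E\<^sup>="] by auto
  moreover have sub: "E\<^sup>* `` {u} \<subseteq> V"
    using built_up_subset[OF assms(1)] assms(3) by (auto elim: rtranclE)
  moreover have "card V \<le> card ?B"
    using built_up_ball[OF assms(1,3), of "card V"] assms(2)
    by (metis le_SucI min.absorb1 mult.right_neutral mult_le_mono2)
  ultimately have "?B = V"
    using built_up_finite[OF assms(1)] by (intro card_seteq) auto
  with \<open>?B \<subseteq> E\<^sup>* `` {u}\<close> assms(4) show ?thesis by auto
qed

section \<open>Counting distant pairs\<close>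

text \<open>The pairs at distance more than \<open>d\<close>, expressed without
  \<open>gdist\<close>; pairs in different components count as far.\<close>

definition far_pairs :: "nat \<Rightarrow> 'a set \<Rightarrow> 'a rel \<Rightarrow> 'a set set" where
  "far_pairs d V E = {{x, y} | x y. x \<in> V \<and> y \<in> V \<and> x \<noteq> y \<and> (x, y) \<notin> E\<^sup>= ^^ d}"

lemma far_pairs_subset: "far_pairs d V E \<subseteq> {e. e \<subseteq> V \<and> card e = 2}"
  by (auto simp: far_pairs_def card_2_iff)

lemma finite_far_pairs: "finite V \<Longrightarrow> finite (far_pairs d V E)"
  by (rule finite_subset[of _ "Pow V"]) (auto simp: far_pairs_def)

lemma sym_relpow: "sym R \<Longrightarrow> sym (R ^^ d)"
proof (induction d)
  case (Suc d)
  show ?case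
  proof (rule symI)
    fix x y assume "(x, y) \<in> R ^^ Suc d"
    then obtain z where "(x, z) \<in> R ^^ d" "(z, y) \<in> R" by auto
    with Suc show "(y, x) \<in> R ^^ Suc d"
      by (meson relpow_Suc_I2 symD)
  qed
qed (auto simp: sym_def)

lemma relpow_mono_rel: "(R :: 'a rel) \<subseteq> S \<Longrightarrow> R ^^ d \<subseteq> S ^^ d"
  by (induction d) auto

text \<open>A far pair of the enlarged graph is an old far pair or consists of \<open>v\<close> and
  a vertex outside the ball around \<open>v\<close>. The ball bound limits the latter, and Pascal's
  rule adds up the two counts.\<close>

lemma card_far_pairs_built_up:
  assumes "built_up k V E"
  shows "card (far_pairs d V E) \<le> (card V - d * k) choose 2"
  using assms
proof (induction rule: built_up.induct)
  case (complete V)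
  let ?E = "{(u, v). u \<in> V \<and> v \<in> V \<and> u \<noteq> v}"
  show ?case
  proof (cases d)
    case 0
    have "card (far_pairs d V ?E) \<le> card {e. e \<subseteq> V \<and> card e = 2}"
      using complete by (intro card_mono far_pairs_subset) simp
    with 0 complete show ?thesis by (simp add: n_subsets)
  next
    case (Suc d')
    \<comment> \<open>Stand still for \<open>d'\<close> steps, then take one edge: every pair is
      within distance \<open>d\<close>.\<close>
    have "(x, x) \<in> ?E\<^sup>= ^^ d'" for x by (induction d') auto
    then have "far_pairs d V ?E = {}"
      unfolding far_pairs_def Suc relpow.simps by blast
    then show ?thesis by simp
  qed
next
  case (attach V E v N)
  let ?E = "E \<union> {v} \<times> N \<union> N \<times> {v}" and ?V = "insert v V"
  have built: "built_up k ?V ?E"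
    using attach.hyps by (rule built_up.attach)
  have fin: "finite V" using attach.hyps(1) by (rule built_up_finite)
  let ?B = "(?E\<^sup>= ^^ d) `` {v}"
  have sym: "sym (?E\<^sup>= ^^ d)"
    by (intro sym_relpow sym_Un built_up_sym[OF built] sym_Id)
  \<comment> \<open>Attaching a vertex cannot increase distances, so old vertices that are far apart
    now were far apart before.\<close>
  have mono: "E\<^sup>= ^^ d \<subseteq> ?E\<^sup>= ^^ d"
    by (intro relpow_mono_rel) auto
  have "far_pairs d ?V ?E \<subseteq> far_pairs d V E \<union> (\<lambda>w. {v, w}) ` (?V - ?B)"
  proof
    fix e assume "e \<in> far_pairs d ?V ?E"
    then obtain x y where e: "e = {x, y}" "x \<in> ?V" "y \<in> ?V" "x \<noteq> y" "(x, y) \<notin> ?E\<^sup>= ^^ d"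
      unfolding far_pairs_def by blast
    then have e': "(y, x) \<notin> ?E\<^sup>= ^^ d"
      using sym by (meson symD)
    consider "x = v" | "y = v" | "x \<in> V" "y \<in> V" using e by auto
    then show "e \<in> far_pairs d V E \<union> (\<lambda>w. {v, w}) ` (?V - ?B)"
    proof cases
      case 3
      then have "e \<in> far_pairs d V E" using e mono unfolding far_pairs_def by blast
      then show ?thesis ..
    next
      case 1
      with e show ?thesis by blast
    next
      case 2
      with e e' show ?thesis by (auto simp: insert_commute)
    qed
  qed
  then have "card (far_pairs d ?V ?E) \<le> card (far_pairs d V E \<union> (\<lambda>w. {v, w}) ` (?V - ?B))"
    using fin finite_far_pairs[OF fin] by (intro card_mono) auto
  also have "\<dots> \<le> card (far_pairs d V E) + card ((\<lambda>w. {v, w}) ` (?V - ?B))"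
    by (rule card_Un_le)
  also have "\<dots> \<le> ((card V - d * k) choose 2) + card (?V - ?B)"
    using attach.IH fin by (intro add_mono card_image_le) auto
  \<comment> \<open>The ball contains \<open>v\<close> itself: the 1 in its bound d k + 1 cancels
    the 1 in the order of \<open>?V\<close>.\<close>
  also have "card (?V - ?B) \<le> card V - d * k"
  proof -
    have "?B \<subseteq> ?V"
    proof -
      have "(?E\<^sup>= ^^ e) `` {v} \<subseteq> ?V" for e
        using built_up_subset[OF built] by (induction e) (auto simp: relcomp.simps)
      then show ?thesis .
    qed
    then have "card (?V - ?B) = card ?V - card ?B"
      using fin by (intro card_Diff_subset) (auto intro: finite_subset)
    then show ?thesis
      using built_up_ball[OF built, of v d] fin attach.hyps(2) by (auto simp: min_def split: if_splits)
  qed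
  \<comment> \<open>Pascal's rule; if \<open>d * k\<close> exceeds \<open>card V\<close>, the
    truncated differences make both sides 0.\<close>
  also have "((card V - d * k) choose 2) + (card V - d * k) \<le> (card ?V - d * k) choose 2"
    using fin attach.hyps(2)
    by (cases "d * k \<le> card V") (auto simp: Suc_diff_le numeral_2_eq_2)
  finally show ?case by simp
qed

section \<open>Distances as relation powers\<close>

lemma relpow_reflcl_iff: "(u, v) \<in> R\<^sup>= ^^ d \<longleftrightarrow> (\<exists>l \<le> d. (u, v) \<in> R ^^ l)"
proof (induction d arbitrary: v)
  case 0
  then show ?case by auto
next
  case (Suc d)
  have "(u, v) \<in> R\<^sup>= ^^ Suc d \<longleftrightarrow> (u, v) \<in> R\<^sup>= ^^ d \<or> (\<exists>w. (u, w) \<in> R\<^sup>= ^^ d \<and> (w, v) \<in> R)"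
    by auto
  also have "\<dots> \<longleftrightarrow> (\<exists>l \<le> d. (u, v) \<in> R ^^ l) \<or> (\<exists>l \<le> d. (u, v) \<in> R ^^ Suc l)"
    unfolding Suc.IH by auto
  also have "\<dots> \<longleftrightarrow> (\<exists>l \<le> Suc d. (u, v) \<in> R ^^ l)"
    by (metis Suc_le_mono le_Suc_eq not0_implies_Suc le0)
  finally show ?case .
qed

text \<open>A potential that changes by at most \<open>c\<close> along each edge bounds distances
  from below. It is applied to positions on the path, with c = 1 for the path and c = k for its
  power.\<close>

lemma relpow_displacement:
  fixes h :: "'a \<Rightarrow> int"
  assumes "\<And>x y. (x, y) \<in> R \<Longrightarrow> \<bar>h x - h y\<bar> \<le> int c" and "(u, v) \<in> R\<^sup>= ^^ d"
  shows "\<bar>h u - h v\<bar> \<le> int (d * c)"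
  using assms(2)
proof (induction d arbitrary: v)
  case (Suc d)
  then obtain w where w: "(u, w) \<in> R\<^sup>= ^^ d" "w = v \<or> (w, v) \<in> R" by auto
  then have "\<bar>h w - h v\<bar> \<le> int c" using assms(1) by auto
  with Suc.IH[OF w(1)] show ?case by (auto simp: algebra_simps)
qed simp

context pair_wf_digraph
begin

text \<open>The assumption on \<open>u\<close> matters for l = 0: the zeroth power relates every
  element of the type to itself, while an empty walk must sit at a vertex.\<close>

lemma awalk_length_iff_relpow:
  assumes "u \<in> pverts G"
  shows "(\<exists>p. awalk u p v \<and> length p = l) \<longleftrightarrow> (u, v) \<in> parcs G ^^ l"
  using assms
proof (induction l arbitrary: u)
  case 0
  then show ?case by (auto simp: awalk_Nil_iff)
next
  case (Suc l)
  have "(\<exists>p. awalk u p v \<and> length p = Suc l) \<longleftrightarrow>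
      (\<exists>w p. (u, w) \<in> parcs G \<and> awalk w p v \<and> length p = l)"
  proof
    assume "\<exists>p. awalk u p v \<and> length p = Suc l"
    then obtain w p where "awalk u ((u, w) # p) v" "length p = l"
      by (auto simp: length_Suc_conv awalk_Cons_iff)
    then show "\<exists>w p. (u, w) \<in> parcs G \<and> awalk w p v \<and> length p = l"
      unfolding awalk_Cons_iff by auto
  next
    assume "\<exists>w p. (u, w) \<in> parcs G \<and> awalk w p v \<and> length p = l"
    then obtain w p where "(u, w) \<in> parcs G" "awalk w p v" "length p = l" by blast
    then show "\<exists>p. awalk u p v \<and> length p = Suc l"
      by (intro exI[of _ "(u, w) # p"]) (simp add: awalk_Cons_iff)
  qed
  also have "\<dots> \<longleftrightarrow> (\<exists>w. (u, w) \<in> parcs G \<and> (w, v) \<in> parcs G ^^ l)"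
    using Suc.IH in_arcsD2 by blast
  also have "\<dots> \<longleftrightarrow> (u, v) \<in> parcs G ^^ Suc l"
    by (meson relpow_Suc_D2 relpow_Suc_I2)
  finally show ?case .
qed

lemma reachable_iff_rtrancl:
  assumes "u \<in> pverts G"
  shows "u \<rightarrow>\<^sup>*\<^bsub>with_proj G\<^esub> v \<longleftrightarrow> (u, v) \<in> (parcs G)\<^sup>*"
  unfolding reachable_awalk rtrancl_is_UN_relpow
  using awalk_length_iff_relpow[OF assms] by blast

text \<open>Reachability makes the set of walk lengths nonempty, so the least length is
  attained.\<close>

lemma gdist_le_iff:
  assumes "u \<rightarrow>\<^sup>*\<^bsub>with_proj G\<^esub> v"
  shows "gdist G u v \<le> d \<longleftrightarrow> (u, v) \<in> (parcs G)\<^sup>= ^^ d"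
proof -
  have u: "u \<in> pverts G" using assms by (rule reachable_in_verts)
  have "\<exists>l. (u, v) \<in> parcs G ^^ l"
    using assms reachable_iff_rtrancl[OF u] rtrancl_imp_relpow by blast
  then have "(u, v) \<in> parcs G ^^ gdist G u v"
    unfolding gdist_def awalk_length_iff_relpow[OF u] by (rule LeastI_ex)
  moreover have "gdist G u v \<le> l" if "(u, v) \<in> parcs G ^^ l" for l
    unfolding gdist_def awalk_length_iff_relpow[OF u] using that by (rule Least_le)
  ultimately show ?thesis
    unfolding relpow_reflcl_iff using order_trans by blast
qed

end

section \<open>Symmetric graphs and their distance sequences\<close>

lemma (in pair_sym_digraph) sym_parcs: "sym (parcs G)"
  using arcs_symmetric by (rule symI)

lemma (in pair_sym_digraph) connected_iff_rtrancl:
  "connected (with_proj G) \<longleftrightarrow>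
     pverts G \<noteq> {} \<and> (\<forall>u \<in> pverts G. \<forall>v \<in> pverts G. (u, v) \<in> (parcs G)\<^sup>*)"
  unfolding connected_def strongly_connected_def
  by (auto simp: reachable_mk_symmetric_eq[OF pair_sym_arcs] reachable_iff_rtrancl)

lemma (in pair_sym_digraph) gdist_commute: "gdist G u v = gdist G v u"
proof -
  have "(\<exists>p. awalk u p v \<and> length p = l) \<longleftrightarrow> (\<exists>p. awalk v p u \<and> length p = l)" for l
  proof -
    have "length (rev_path p) = length p" for p :: "('a \<times> 'a) list"
      by (induction p) auto
    then show ?thesis by (metis awalk_rev_path)
  qed
  then show ?thesis by (simp add: gdist_def)
qed

lemma (in pair_sym_digraph) pair_dist_doubleton: "pair_dist G {u, v} = gdist G u v"
  unfolding pair_dist_def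
  by (rule the_equality) (auto simp: doubleton_eq_iff gdist_commute)

lemma length_filter_distance_sequence:
  assumes "pair_graph G" and "connected (with_proj G)"
  shows "length (filter (\<lambda>x. d < x) (distance_sequence G)) =
         card (far_pairs d (pverts G) (parcs G))"
proof -
  interpret pair_graph G by fact
  let ?A = "{e. e \<subseteq> pverts G \<and> card e = 2}"
  have fin: "finite ?A" using pair_finite_verts by auto
  \<comment> \<open>Connectedness enters here: \<open>gdist\<close> is meaningful only for reachable
    pairs.\<close>
  have far: "d < pair_dist G {x, y} \<longleftrightarrow> (x, y) \<notin> (parcs G)\<^sup>= ^^ d"
    if "x \<in> pverts G" "y \<in> pverts G" for x y
    using assms(2) that gdist_le_iff[of x y d] unfolding connected_iff_rtrancl pair_dist_doubleton
    by (auto simp: reachable_iff_rtrancl not_le[symmetric])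
  have "length (filter (\<lambda>x. d < x) (distance_sequence G)) =
      size (filter_mset (\<lambda>x. d < x) (mset (distance_sequence G)))"
    by (metis mset_filter size_mset)
  also have "\<dots> = card {e \<in> ?A. d < pair_dist G e}"
    using fin by (simp add: distance_sequence_def filter_mset_image_mset filter_mset_mset_set)
  also have "{e \<in> ?A. d < pair_dist G e} = far_pairs d (pverts G) (parcs G)"
  proof (intro set_eqI iffI)
    fix e assume "e \<in> {e \<in> ?A. d < pair_dist G e}"
    then obtain x y where "e = {x, y}" "x \<noteq> y" "x \<in> pverts G" "y \<in> pverts G"
        "d < pair_dist G {x, y}"
      by (auto simp: card_2_iff)
    then show "e \<in> far_pairs d (pverts G) (parcs G)"
      using far unfolding far_pairs_def by blast
  next
    fix e assume "e \<in> far_pairs d (pverts G) (parcs G)"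
    then obtain x y where "e = {x, y}" "x \<noteq> y" "x \<in> pverts G" "y \<in> pverts G"
        "(x, y) \<notin> (parcs G)\<^sup>= ^^ d"
      unfolding far_pairs_def by blast
    then show "e \<in> {e \<in> ?A. d < pair_dist G e}"
      using far by simp
  qed
  finally show ?thesis .
qed

lemma length_distance_sequence:
  assumes "finite (pverts G)"
  shows "length (distance_sequence G) = card (pverts G) choose 2"
  using assms by (simp add: distance_sequence_def n_subsets
      del: size_mset flip: size_mset)

text \<open>The count for d = 0: the zeroth power relates no two distinct vertices, so every pair is
  far and the filter drops no entry.\<close>

lemma distance_sequence_pos:
  assumes "pair_graph G" and "connected (with_proj G)" and "x \<in> set (distance_sequence G)"
  shows "0 < x"
proof -
  interpret pair_graph G by fact
  have "far_pairs 0 (pverts G) (parcs G) = {e. e \<subseteq> pverts G \<and> card e = 2}"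
    by (auto simp: far_pairs_def card_2_iff)
  then have "length (filter (\<lambda>x. 0 < x) (distance_sequence G)) = length (distance_sequence G)"
    using length_filter_distance_sequence[OF assms(1,2), of 0] pair_finite_verts
    by (simp add: length_distance_sequence n_subsets)
  then show ?thesis
    using assms(3) by (metis length_filter_less less_irrefl)
qed

section \<open>Comparing sorted sequences\<close>

text \<open>If the i-th entry of \<open>xs\<close> exceeded d = \<open>ys ! i\<close>, all entries
  of \<open>xs\<close> from i on would exceed d, but in \<open>ys\<close> only entries strictly
  after i can: one too few.\<close>

lemma sorted_nth_le_if_counts_le:
  fixes xs ys :: "nat list"
  assumes "sorted xs" and "sorted ys" and "length xs = length ys"
    and "\<And>d. length (filter (\<lambda>x. d < x) xs) \<le> length (filter (\<lambda>y. d < y) ys)"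
    and i: "i < length xs"
  shows "xs ! i \<le> ys ! i"
proof (rule ccontr)
  assume "\<not> xs ! i \<le> ys ! i"
  then have less: "ys ! i < xs ! i" by simp
  let ?d = "ys ! i" and ?n = "length xs"
  have "{i..<?n} \<subseteq> {j. j < ?n \<and> ?d < xs ! j}"
    using less sorted_nth_mono[OF assms(1), of i] by fastforce
  then have "card {i..<?n} \<le> length (filter (\<lambda>x. ?d < x) xs)"
    unfolding length_filter_conv_card by (intro card_mono) auto
  also have "\<dots> \<le> length (filter (\<lambda>y. ?d < y) ys)" by (rule assms(4))
  also have "\<dots> \<le> card {Suc i..<?n}"
    unfolding length_filter_conv_card
  proof (intro card_mono subsetI)
    fix j assume j: "j \<in> {j. j < length ys \<and> ?d < ys ! j}"
    then have "\<not> j \<le> i"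
      using sorted_nth_mono[OF assms(2), of j i] i assms(3) by auto
    then show "j \<in> {Suc i..<?n}" using j assms(3) by auto
  qed simp
  finally show False using i by simp
qed

text \<open>One coordinate is replaced at a time, from the left. The intermediate lists need not be
  sorted, so monotonicity of \<open>g\<close> is used on arbitrary positive lists.\<close>

lemma nondecreasing_coords_le:
  assumes "nondecreasing_coords g" and "length xs = length ys"
    and "\<forall>x \<in> set xs. 0 < x" and "\<And>i. i < length xs \<Longrightarrow> xs ! i \<le> ys ! i"
  shows "g xs \<le> g ys"
proof -
  have pos: "0 < xs ! i" if "i < length xs" for i using assms(3) that by auto
  have "g xs \<le> g (take i ys @ drop i xs)" if "i \<le> length xs" for i
    using that
  proof (induction i)
    case (Suc i)
    let ?zs = "take i ys @ drop i xs"
    have len: "length ?zs = length xs" using Suc.prems assms(2) by simp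
    have nth: "?zs ! j = (if j < i then ys ! j else xs ! j)" if "j < length xs" for j
      using that Suc.prems assms(2) by (auto simp: nth_append)
    \<comment> \<open>Monotonicity is available at positive lists only; replaced entries dominate
      positive ones.\<close>
    have "\<forall>z \<in> set ?zs. 0 < z"
      unfolding all_set_conv_all_nth len using nth pos assms(4) by (auto intro: less_le_trans)
    moreover have "?zs ! i \<le> ys ! i" using nth[of i] assms(4)[of i] Suc.prems by simp
    ultimately have "g ?zs \<le> g (?zs[i := ys ! i])"
      using assms(1) Suc.prems len unfolding nondecreasing_coords_def
      by (metis Suc_le_eq)
    also have "?zs[i := ys ! i] = take (Suc i) ys @ drop (Suc i) xs"
      using Suc.prems assms(2)
      by (intro nth_equalityI) (auto simp: nth_list_update nth_append min_def less_Suc_eq)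
    finally show ?case using Suc by simp
  qed simp
  from this[of "length xs"] show ?thesis using assms(2) by simp
qed

lemma nondecreasing_coords_distance_sequence_le:
  assumes "pair_graph G" and "connected (with_proj G)"
    and "pair_graph H" and "connected (with_proj H)"
    and "card (pverts G) = card (pverts H)"
    and "\<And>d. card (far_pairs d (pverts G) (parcs G)) \<le> card (far_pairs d (pverts H) (parcs H))"
    and "nondecreasing_coords g"
  shows "g (distance_sequence G) \<le> g (distance_sequence H)"
proof -
  interpret G: pair_graph G by fact
  interpret H: pair_graph H by fact
  have len: "length (distance_sequence G) = length (distance_sequence H)"
    using assms(5) G.pair_finite_verts H.pair_finite_verts by (simp add: length_distance_sequence)
  show ?thesis
  proof (rule nondecreasing_coords_le[OF assms(7) len])
    show "\<forall>x \<in> set (distance_sequence G). 0 < x"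
      using distance_sequence_pos[OF assms(1,2)] by blast
    have sorted: "sorted (distance_sequence G)" "sorted (distance_sequence H)"
      by (simp_all add: distance_sequence_def)
    show "distance_sequence G ! i \<le> distance_sequence H ! i"
      if "i < length (distance_sequence G)" for i
      using len that assms(6)
      by (intro sorted_nth_le_if_counts_le sorted)
        (simp_all add: length_filter_distance_sequence assms(1-4))
  qed
qed

section \<open>Powers of paths\<close>

text \<open>An edge of the power moves at most \<open>k\<close> positions along the path, so
  vertices more than \<open>d * k\<close> positions apart are at distance more than
  \<open>d\<close>. For the count only this lower bound is required.\<close>

lemma path_graph_power:
  assumes "is_path_graph n P" and "1 \<le> k" and "1 \<le> n"
  shows "pair_graph (graph_power P k)" and "connected (with_proj (graph_power P k))"
    and "(n - d * k) choose 2 \<le> card (far_pairs d (pverts P) (parcs (graph_power P k)))"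
proof -
  let ?Q = "graph_power P k"
  interpret P: pair_graph P using assms(1) by (rule pair_graph_is_path_graph)
  obtain f where f: "bij_betw f {..<n} (pverts P)"
    and E: "parcs P = {(f i, f j) | i j. i < n \<and> j < n \<and> (j = Suc i \<or> i = Suc j)}"
    using assms(1) unfolding is_path_graph_def by blast
  \<comment> \<open>The position on the path, as an integer so that differences have absolute
    values.\<close>
  define h where "h v = int (the_inv_into {..<n} f v)" for v
  have inj: "inj_on f {..<n}" and img: "f ` {..<n} = pverts P"
    using f by (auto simp: bij_betw_def)
  have h: "h (f i) = int i" if "i < n" for i
    using that the_inv_into_f_f[OF inj, of i] by (simp add: h_def)
  have Qsym: "sym (parcs ?Q)"
    using symD[OF sym_rtrancl[OF P.sym_parcs]]
    by (auto simp: sym_def graph_power_def P.gdist_commute P.reachable_iff_rtrancl)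
  have fin: "finite (parcs ?Q)"
    by (rule finite_subset[of _ "pverts P \<times> pverts P"])
      (use P.pair_finite_verts in \<open>auto simp: graph_power_def\<close>)
  show Q: "pair_graph ?Q"
    by unfold_locales
      (use fin Qsym P.pair_finite_verts in \<open>auto simp: graph_power_def symmetric_def\<close>)
  interpret Q: pair_graph ?Q by fact
  have sub: "parcs P \<subseteq> parcs ?Q"
  proof (rule subrelI)
    fix x y assume xy: "(x, y) \<in> parcs P"
    then have V: "x \<in> pverts P" "y \<in> pverts P" "x \<noteq> y"
      using P.wellformed' P.no_loops' by auto
    then have r: "x \<rightarrow>\<^sup>*\<^bsub>with_proj P\<^esub> y" using xy P.reachable_iff_rtrancl by blast
    have "gdist P x y \<le> 1" using xy P.gdist_le_iff[OF r, of 1] by simp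
    with V r assms(2) show "(x, y) \<in> parcs ?Q" by (simp add: graph_power_def)
  qed
  have zero: "(f 0, f i) \<in> (parcs ?Q)\<^sup>*" if "i < n" for i
    using that
  proof (induction i)
    case (Suc i)
    have "(f i, f (Suc i)) \<in> parcs ?Q" using Suc.prems unfolding E by (intro subsetD[OF sub[unfolded E]] CollectI exI[of _ i] exI[of _ "Suc i"]) auto
    with Suc show ?case by (simp add: rtrancl.rtrancl_into_rtrancl)
  qed simp
  have "(x, y) \<in> (parcs ?Q)\<^sup>*" if "x \<in> pverts P" "y \<in> pverts P" for x y
  proof -
    have "(f 0, x) \<in> (parcs ?Q)\<^sup>*" "(f 0, y) \<in> (parcs ?Q)\<^sup>*"
      using zero that unfolding img[symmetric] by blast+
    then show ?thesis
      using sym_rtrancl[OF Qsym] by (meson rtrancl_trans symD)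
  qed
  then show "connected (with_proj ?Q)"
    using assms(3) img unfolding Q.connected_iff_rtrancl
    by (auto simp: graph_power_def lessThan_empty_iff)
  have hP: "\<bar>h x - h y\<bar> \<le> int 1" if "(x, y) \<in> parcs P" for x y
    using that by (auto simp: E h)
  have hQ: "\<bar>h x - h y\<bar> \<le> int k" if "(x, y) \<in> parcs ?Q" for x y
  proof -
    from that have "(x, y) \<in> (parcs P)\<^sup>= ^^ k"
      using P.gdist_le_iff by (auto simp: graph_power_def)
    from relpow_displacement[OF hP this] show ?thesis by simp
  qed
  \<comment> \<open>For i < j the positions i and j + d k differ by more than d k. There are 0 + 1 +
    ... + (n - d k - 1) such index pairs, which is the binomial coefficient.\<close>
  let ?S = "SIGMA j:{..<n - d * k}. {..<j}"
  let ?F = "\<lambda>(j, i). {f i, f (j + d * k)}"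
  have "inj_on ?F ?S"
  proof (rule inj_onI, clarify)
    \<comment> \<open>The index without the shift is always the smaller one, so equal sets cannot
      match crosswise.\<close>
    fix j i j' i'
    assume *: "j < n - d * k" "i < j" "j' < n - d * k" "i' < j'"
      "{f i, f (j + d * k)} = {f i', f (j' + d * k)}"
    then show "j = j' \<and> i = i'"
      using inj_on_eq_iff[OF inj] by (auto simp: doubleton_eq_iff less_diff_conv)
  qed
  moreover have "?F ` ?S \<subseteq> far_pairs d (pverts P) (parcs ?Q)"
  proof clarify
    fix j i assume ij: "j < n - d * k" "i < j"
    let ?x = "f i" and ?y = "f (j + d * k)"
    have n: "i < n" "j + d * k < n" using ij by auto
    have "(?x, ?y) \<notin> (parcs ?Q)\<^sup>= ^^ d"
      using relpow_displacement[of "parcs ?Q" h k ?x ?y d] hQ ij n by (auto simp: h)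
    moreover have "?x \<noteq> ?y" using inj_on_eq_iff[OF inj, of i "j + d * k"] n ij by simp
    ultimately show "{?x, ?y} \<in> far_pairs d (pverts P) (parcs ?Q)"
      using n img unfolding far_pairs_def by blast
  qed
  ultimately have "card ?S \<le> card (far_pairs d (pverts P) (parcs ?Q))"
    using finite_far_pairs[OF P.pair_finite_verts] by (metis card_inj_on_le)
  moreover have "card ?S = (n - d * k) choose 2"
    by (simp add: lessThan_atLeast0 Sum_Ico_nat choose_two)
  ultimately show "(n - d * k) choose 2 \<le> card (far_pairs d (pverts P) (parcs ?Q))"
    by simp
qed

section \<open>Maximal degenerate graphs\<close>

text \<open>An induced subgraph is determined by its vertex set, so quantifying over subgraphs means
  quantifying over sets \<open>W\<close>. Well-formedness suffices, which makes the lemma applicable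
  to \<open>add_edge u v G\<close> too.\<close>

lemma degenerate_iff_rel_degenerate:
  assumes "pair_wf_digraph G"
  shows "degenerate k G \<longleftrightarrow> rel_degenerate k (pverts G) (parcs G)"
proof -
  interpret pair_wf_digraph G by fact
  have deg: "out_degree (with_proj H) v = card (parcs H `` {v})" for H :: "'a pair_pre_digraph" and v
  proof -
    have "out_arcs (with_proj H) v = Pair v ` (parcs H `` {v})"
      by (auto simp: out_arcs_def)
    then show ?thesis by (simp add: out_degree_def card_image inj_on_def)
  qed
  have induced: "induced_subgraph (with_proj H) (with_proj G) \<longleftrightarrow>
      pverts H \<subseteq> pverts G \<and> parcs H = parcs G \<inter> pverts H \<times> pverts H" for H
  proof -
    have eq: "{e \<in> parcs G. fst e \<in> pverts H \<and> snd e \<in> pverts H} =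
        parcs G \<inter> pverts H \<times> pverts H"
      by auto
    have "pair_wf_digraph H" if "parcs H = parcs G \<inter> pverts H \<times> pverts H"
      by unfold_locales (simp_all add: that mem_Times_iff)
    then show ?thesis
      using assms
      unfolding induced_subgraph_def subgraph_def compatible_def wf_digraph_wp_iff with_proj_simps eq
      by blast
  qed
  have restr: "(parcs G \<inter> W \<times> W) `` {v} = parcs G `` {v} \<inter> W" if "v \<in> W" for v W
    using that by auto
  show ?thesis
  proof
    assume L: "degenerate k G"
    show "rel_degenerate k (pverts G) (parcs G)"
      unfolding rel_degenerate_def
    proof (intro allI impI)
      fix W assume W: "W \<subseteq> pverts G" "W \<noteq> {}"
      let ?H = "\<lparr>pverts = W, parcs = parcs G \<inter> W \<times> W\<rparr>"
      have "\<exists>v \<in> pverts ?H. out_degree (with_proj ?H) v \<le> k"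
        using L W unfolding degenerate_def induced by (metis pair_pre_digraph.select_convs)
      then show "\<exists>v \<in> W. card (parcs G `` {v} \<inter> W) \<le> k"
        by (auto simp: deg restr)
    qed
  next
    assume R: "rel_degenerate k (pverts G) (parcs G)"
    show "degenerate k G"
      unfolding degenerate_def induced
    proof (intro allI impI)
      fix H :: "'a pair_pre_digraph"
      assume H: "(pverts H \<subseteq> pverts G \<and> parcs H = parcs G \<inter> pverts H \<times> pverts H) \<and>
        pverts H \<noteq> {}"
      then obtain v where "v \<in> pverts H" "card (parcs G `` {v} \<inter> pverts H) \<le> k"
        using R unfolding rel_degenerate_def by meson
      then show "\<exists>v \<in> pverts H. out_degree (with_proj H) v \<le> k"
        using H restr by (metis deg)
    qed
  qed
qed

lemma maximal_degenerate_built_up: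
  assumes "pair_graph G" and "maximal_degenerate k G" and "Suc k \<le> card (pverts G)"
  shows "built_up k (pverts G) (parcs G)"
proof -
  interpret pair_graph G by fact
  show ?thesis
  proof (rule maximal_rel_degenerate_built_up)
    show "finite (pverts G)" by (rule pair_finite_verts)
    show "parcs G \<subseteq> pverts G \<times> pverts G" using wellformed' by auto
    show "sym (parcs G)" by (rule sym_parcs)
    show "irrefl (parcs G)" using no_loops' by (auto simp: irrefl_def)
    show "rel_degenerate k (pverts G) (parcs G)"
      using assms(2) degenerate_iff_rel_degenerate[OF pair_wf_digraph]
      by (simp add: maximal_degenerate_def)
    fix u v assume uv: "u \<in> pverts G" "v \<in> pverts G" "u \<noteq> v" "(u, v) \<notin> parcs G"
    have "pair_wf_digraph (add_edge u v G)"
      by unfold_locales (use uv wellformed' in \<open>auto simp: add_edge_def\<close>)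
    moreover have "\<not> degenerate k (add_edge u v G)"
      using assms(2) uv by (simp add: maximal_degenerate_def)
    ultimately show "\<not> rel_degenerate k (pverts G) ({(u, v), (v, u)} \<union> parcs G)"
      by (simp add: degenerate_iff_rel_degenerate) (simp add: add_edge_def)
  qed (fact assms(3))
qed

theorem theorem3:
  fixes k n :: nat
    and G P :: "'a pair_pre_digraph"
    and I :: "'a pair_pre_digraph \<Rightarrow> real"
  assumes "1 \<le> k" and "k \<le> n - 1"
    and "pair_graph G" and "card (pverts G) = n" and "maximal_degenerate k G"
    and "is_path_graph n P"
  shows "(nondecreasing_distance_based I \<longrightarrow> I G \<le> I (graph_power P k)) \<and>
         (nonincreasing_distance_based I \<longrightarrow> I G \<ge> I (graph_power P k))"
proof -
  let ?Q = "graph_power P k"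
  interpret G: pair_graph G by fact
  \<comment> \<open>As k \<ge> 1, the truncated \<open>n - 1\<close> is positive, so k + 1 \<le>
    n.\<close>
  have n: "1 \<le> n" "Suc k \<le> card (pverts G)" using assms(1,2,4) by auto
  note built = maximal_degenerate_built_up[OF assms(3,5) n(2)]
  note Q = path_graph_power[OF assms(6,1) n(1)]
  have conG: "connected (with_proj G)"
    using built_up_connected[OF built assms(1)] n unfolding G.connected_iff_rtrancl by auto
  have V: "pverts ?Q = pverts P" by (simp add: graph_power_def)
  have cardP: "card (pverts P) = n"
    using assms(6) unfolding is_path_graph_def by (metis bij_betw_same_card card_lessThan)
  \<comment> \<open>The bounds for \<open>G\<close> and for the power meet at (n - d k) choose
    2.\<close>
  have far: "card (far_pairs d (pverts G) (parcs G)) \<le> card (far_pairs d (pverts ?Q) (parcs ?Q))" for d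
    using order_trans[OF card_far_pairs_built_up[OF built] Q(3)[of d, folded assms(4)]]
    by (simp add: V)
  have le: "g (distance_sequence G) \<le> g (distance_sequence ?Q)" if "nondecreasing_coords g" for g
    using assms(3,4) conG Q(1,2) far that cardP V
    by (intro nondecreasing_coords_distance_sequence_le) auto
  show ?thesis
  proof (intro conjI impI)
    assume "nondecreasing_distance_based I"
    then show "I G \<le> I ?Q"
      using le assms(3) conG Q(1,2)
      unfolding nondecreasing_distance_based_def index_given_by_def by force
  next
    assume "nonincreasing_distance_based I"
    then obtain g where g: "index_given_by I g" "nonincreasing_coords g"
      unfolding nonincreasing_distance_based_def by blast
    \<comment> \<open>Negating \<open>g\<close> reduces the nonincreasing case to the inequality
      already proved.\<close>
    then have "nondecreasing_coords (\<lambda>xs. - g xs)"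
      by (simp add: nondecreasing_coords_def nonincreasing_coords_def)
    from le[OF this] show "I ?Q \<le> I G"
      using g(1) assms(3) conG Q(1,2) unfolding index_given_by_def by simp
  qed
qed

end
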